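(* Let $G$ be a finitely generated group with generators $G_1=\{g_1^{\pm1},g_2^{\pm1},\dots,g_k^{\pm1}\}$ and let $T:G\times X\to X$ be a continuous group action on a compact metric space $X$. If $T$ satisfies the specification property, then every $g\in G_1$ with infinite order (viewed as the map $x\mapsto T(g,x)$) has the specification property.
   Context: Group action version: let $G_n$ be the set of products $g_{i_n}\cdots g_{i_1}$ with all $g_{i_j}\in G_1\cup\{id\}$. For $h,g\in G$ put $d_G(h,g)=|h^{-1}g|:=\inf\{n\ge1:h^{-1}g\in G_n\}$; for subsets $\Lambda,\Lambda'\subset G$, $d_G(\Lambda,\Lambda')=\inf\{d_G(h,g):h\in\Lambda,g\in\Lambda'\}$. A continuous group action of $G$ on a compact metric space $(X,d)$ has the specification property if for every $\delta>0$ there is $p(\delta)>0$ such that for any finite families $(\Lambda_i)_{i\in\mathcal I}$ of subsets of $G$ and $(x_i)_{i\in\mathcal I}$ of points of $X$ with $d_G(\Lambda_i,\Lambda_j)>p(\delta)$ for all $i\ne j$, there is $x\in X$ with $d(g_ix,g_ix_i)<\delta$ for every $i\in\mathcal I$ and every $g_i\in\Lambda_i$. Single map version: a continuous map $f:X\to X$ has the specification property if for every $\delta>0$ there is an integer $p(\delta)\ge1$ such that for every $k\ge1$, any points $x_1,\dots,x_k\in X$ and any positive integers $n_1,\dots,n_k$ and $p_1,\dots,p_k$ with $p_i\ge p(\delta)$, there is $x\in X$ with $d(f^j(x),f^j(x_1))\le\delta$ for $0\le j\le n_1$ and $d(f^{j+n_1+p_1+\dots+n_{i-1}+p_{i-1}}(x),f^j(x_i))\le\delta$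 for $2\le i\le k$ and $0\le j\le n_i$. An element $g\in G$ has infinite order if $g^n\neq id$ for all $n\ge1$. *)

theory Defs
  imports
    "HOL-Algebra.Group_Action"
    "HOL-Algebra.Generated_Groups"
    "HOL-Analysis.Abstract_Metric_Spaces"
    "HOL-Library.Extended_Real"
begin

text \<open>The set \<open>G_n\<close> of products of \<open>n\<close> elements of \<open>S \<union> {id}\<close>. The list
  \<open>[a_n, ..., a_1]\<close> stands for the product \<open>a_n \<cdots> a_1\<close>.\<close>

definition word_ball :: "('g, 'm) monoid_scheme \<Rightarrow> 'g set \<Rightarrow> nat \<Rightarrow> 'g set"
  where "word_ball G S n =
    {foldr (mult G) ws (one G) | ws. length ws = n \<and> set ws \<subseteq> insert (one G) S}"

text \<open>As the infimum is over \<open>n \<ge> 1\<close>, every group element has distance \<open>1\<close> to itself. The distances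
  are extended naturals, so that an infimum over the empty set is \<open>\<infinity>\<close>.\<close>

definition word_dist :: "('g, 'm) monoid_scheme \<Rightarrow> 'g set \<Rightarrow> 'g \<Rightarrow> 'g \<Rightarrow> enat"
  where "word_dist G S h g =
    (INF n \<in> {n. 1 \<le> n \<and> mult G (m_inv G h) g \<in> word_ball G S n}. enat n)"

definition word_setdist :: "('g, 'm) monoid_scheme \<Rightarrow> 'g set \<Rightarrow> 'g set \<Rightarrow> 'g set \<Rightarrow> enat"
  where "word_setdist G S A B = (INF (h, g) \<in> A \<times> B. word_dist G S h g)"

text \<open>The finitely generated group carries the discrete topology.\<close>

definition continuous_group_action ::
    "('g, 'm) monoid_scheme \<Rightarrow> 'x set \<Rightarrow> ('x \<Rightarrow> 'x \<Rightarrow> real) \<Rightarrow> ('g \<Rightarrow> 'x \<Rightarrow> 'x) \<Rightarrow> bool"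
  where "continuous_group_action G X d T \<longleftrightarrow>
    group_action G X T \<and>
    continuous_map
      (prod_topology (discrete_topology (carrier G)) (Metric_space.mtopology X d))
      (Metric_space.mtopology X d) (\<lambda>(g, x). T g x)"

text \<open>Finite families are indexed by finite sets of natural numbers; the members \<open>\<Lambda> i\<close>
  may be infinite or empty.\<close>

definition action_specification ::
    "('g, 'm) monoid_scheme \<Rightarrow> 'g set \<Rightarrow> 'x set \<Rightarrow> ('x \<Rightarrow> 'x \<Rightarrow> real) \<Rightarrow> ('g \<Rightarrow> 'x \<Rightarrow> 'x) \<Rightarrow> bool"
  where "action_specification G S X d T \<longleftrightarrow>
    (\<forall>\<delta>>0. \<exists>p::real. p > 0 \<and>
      (\<forall>(I::nat set) (\<Lambda>::nat \<Rightarrow> 'g set) (x::nat \<Rightarrow> 'x).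
        finite I \<and> (\<forall>i\<in>I. \<Lambda> i \<subseteq> carrier G) \<and> (\<forall>i\<in>I. x i \<in> X) \<and>
        (\<forall>i\<in>I. \<forall>j\<in>I. i \<noteq> j \<longrightarrow>
          ereal p < ereal_of_enat (word_setdist G S (\<Lambda> i) (\<Lambda> j))) \<longrightarrow>
        (\<exists>y\<in>X. \<forall>i\<in>I. \<forall>g\<in>\<Lambda> i. d (T g y) (T g (x i)) < \<delta>)))"

definition map_specification :: "'x set \<Rightarrow> ('x \<Rightarrow> 'x \<Rightarrow> real) \<Rightarrow> ('x \<Rightarrow> 'x) \<Rightarrow> bool"
  where "map_specification X d f \<longleftrightarrow>
    continuous_map (Metric_space.mtopology X d) (Metric_space.mtopology X d) f \<and>
    (\<forall>\<delta>>0. \<exists>p\<^sub>0::nat. p\<^sub>0 \<ge> 1 \<and>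
      (\<forall>(k::nat) (x::nat \<Rightarrow> 'x) (n::nat \<Rightarrow> nat) (p::nat \<Rightarrow> nat).
        k \<ge> 1 \<and> (\<forall>i\<in>{1..k}. x i \<in> X \<and> n i \<ge> 1 \<and> p i \<ge> 1 \<and> p i \<ge> p\<^sub>0) \<longrightarrow>
        (\<exists>y\<in>X.
          (\<forall>j\<le>n 1. d ((f ^^ j) y) ((f ^^ j) (x 1)) \<le> \<delta>) \<and>
          (\<forall>i\<in>{2..k}. \<forall>j\<le>n i.
            d ((f ^^ (j + (\<Sum>l=1..<i. n l + p l))) y) ((f ^^ j) (x i)) \<le> \<delta>))))"

end

theory Submission
  imports Defs
begin

text \<open>Word balls of a finitely generated group are finite, while the powers of an element \<open>g\<close> of
  infinite order are pairwise distinct, so all sufficiently high powers of \<open>g\<close> and their inverses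
  leave a given ball. Hence segments \<open>{g\<^sup>m | a\<^sub>i \<le> m \<le> a\<^sub>i + n\<^sub>i}\<close> separated by long enough gaps are far
  apart in the word metric. The specification property of the action, applied to these segments and
  the points \<open>x\<^sub>i\<close> moved by \<open>g\<close> to the power \<open>-a\<^sub>i\<close>, gives a shadowing point for \<open>T g\<close>.\<close>

lemma finite_word_ball:
  assumes "finite S"
  shows "finite (word_ball G S n)"
proof -
  have "finite {ws. set ws \<subseteq> insert (one G) S \<and> length ws = n}"
    using assms by (intro finite_lists_length_eq) simp
  moreover have "word_ball G S n =
      (\<lambda>ws. foldr (mult G) ws (one G)) ` {ws. set ws \<subseteq> insert (one G) S \<and> length ws = n}"
    unfolding word_ball_def by blast
  ultimately show ?thesis by simp
qed

text \<open>Both distances are infima, so excluding every length up to \<open>N\<close> bounds them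
  below, also when an infimum is over the empty set. Letting the hypothesis range over all
  \<open>n \<le> N\<close> avoids showing that the balls increase with \<open>n\<close>.\<close>

lemma Suc_le_word_setdist:
  assumes "\<And>a b n. a \<in> A \<Longrightarrow> b \<in> B \<Longrightarrow> n \<le> N \<Longrightarrow> mult G (m_inv G a) b \<notin> word_ball G S n"
  shows "enat (Suc N) \<le> word_setdist G S A B"
  unfolding word_setdist_def word_dist_def
proof (clarsimp intro!: INF_greatest)
  fix a b n
  assume "a \<in> A" "b \<in> B" "mult G (m_inv G a) b \<in> word_ball G S n"
  with assms show "Suc N \<le> n"
    by (meson not_less_eq_eq)
qed

context group
begin

lemma inj_nat_pow_infinite_order:
  assumes g: "g \<in> carrier G" and order: "\<And>n::nat. n \<ge> 1 \<Longrightarrow> g [^] n \<noteq> \<one>"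
  shows "inj (\<lambda>n::nat. g [^] n)"
proof (rule linorder_injI)
  fix m n :: nat
  assume "m < n"
  then have "g [^] n = g [^] m \<otimes> g [^] (n - m)"
    using g by (simp add: nat_pow_mult)
  then show "g [^] m \<noteq> g [^] n"
    using g order[of "n - m"] \<open>m < n\<close> by simp
qed

text \<open>Both power maps are injective, so the exponents that land in \<open>B\<close> form a
  finite, hence bounded set. Inverses are treated separately because \<open>B\<close> need not be
  symmetric.\<close>

lemma eventually_nat_pow_notin_finite:
  assumes "g \<in> carrier G" "\<And>n::nat. n \<ge> 1 \<Longrightarrow> g [^] n \<noteq> \<one>" "finite B"
  shows "\<exists>M. \<forall>m\<ge>M. g [^] (m::nat) \<notin> B \<and> inv (g [^] m) \<notin> B"
proof -
  have "inj (\<lambda>m::nat. inv (g [^] m))"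
    using inj_nat_pow_infinite_order[OF assms(1,2)] assms(1)
    unfolding inj_def by (metis inv_inv nat_pow_closed)
  then have "finite ((\<lambda>m::nat. g [^] m) -` B \<union> (\<lambda>m::nat. inv (g [^] m)) -` B)"
    using assms inj_nat_pow_infinite_order by (auto intro: finite_vimageI)
  then obtain M where "\<forall>m \<in> (\<lambda>m::nat. g [^] m) -` B \<union> (\<lambda>m::nat. inv (g [^] m)) -` B. m < M"
    using finite_nat_set_iff_bounded by blast
  then have "\<forall>m\<ge>M. g [^] m \<notin> B \<and> inv (g [^] m) \<notin> B"
    by (auto dest: leD)
  then show ?thesis ..
qed

text \<open>This brings quotients of two powers into one of the two forms that
  \<open>eventually_nat_pow_notin_finite\<close> excludes, with natural exponents
  throughout.\<close>

lemma inv_nat_pow_mult_nat_pow: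
  fixes m n :: nat
  assumes "g \<in> carrier G"
  shows "inv (g [^] m) \<otimes> g [^] n =
    (if m \<le> n then g [^] (n - m) else inv (g [^] (m - n)))"
proof (cases "m \<le> n")
  case True
  then have "g [^] n = g [^] m \<otimes> g [^] (n - m)"
    using assms by (simp add: nat_pow_mult)
  then show ?thesis
    using True assms by (simp add: m_assoc[symmetric])
next
  case False
  then have "g [^] m = g [^] n \<otimes> g [^] (m - n)"
    using assms by (simp add: nat_pow_mult)
  then show ?thesis
    using False assms by (simp add: inv_mult_group m_assoc)
qed

end

lemma (in group_action) funpow_eq_nat_pow:
  assumes "g \<in> carrier G" "x \<in> E"
  shows "(\<phi> g ^^ n) x = \<phi> (g [^]\<^bsub>G\<^esub> n) x"
proof (induction n)
  case 0
  then show ?case using fun_cong[OF id_eq_one, of x] assms by simp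
next
  case (Suc n)
  interpret group G using group_hom group_hom.axioms(1) by blast
  \<comment> \<open>The recursion of \<open>[^]\<close> puts the new factor on the right, but the
    iterate applies the new map last, so the factor has to stand on the left.\<close>
  have "g [^]\<^bsub>G\<^esub> Suc n = g \<otimes>\<^bsub>G\<^esub> g [^]\<^bsub>G\<^esub> n"
    using assms by (simp only: nat_pow_Suc2)
  then show ?case
    using Suc assms composition_rule by simp
qed

text \<open>The map is the joint action composed with the inclusion of the slice over
  \<open>g\<close>.\<close>

lemma continuous_group_action_apply:
  assumes "continuous_group_action G X d T" "g \<in> carrier G"
  shows "continuous_map (Metric_space.mtopology X d) (Metric_space.mtopology X d) (T g)"
proof -
  let ?M = "Metric_space.mtopology X d"
  have "continuous_map ?M (prod_topology (discrete_topology (carrier G)) ?M) (\<lambda>x. (g, x))"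
    using assms(2) by (intro continuous_map_pairedI) auto
  moreover have "continuous_map (prod_topology (discrete_topology (carrier G)) ?M) ?M (\<lambda>(g, x). T g x)"
    using assms(1) by (simp add: continuous_group_action_def)
  ultimately have "continuous_map ?M ?M ((\<lambda>(g, x). T g x) \<circ> (\<lambda>x. (g, x)))"
    by (rule continuous_map_compose)
  then show ?thesis by (simp add: o_def)
qed

theorem lemma2p1:
  fixes G :: "('g, 'm) monoid_scheme" (structure)
    and gen :: "nat \<Rightarrow> 'g" and k :: nat and G1 :: "'g set"
    and X :: "'x set" and d :: "'x \<Rightarrow> 'x \<Rightarrow> real"
    and T :: "'g \<Rightarrow> 'x \<Rightarrow> 'x" and g :: 'g
  assumes "group G"
    and "\<And>i. i \<in> {1..k} \<Longrightarrow> gen i \<in> carrier G"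
    and "G1 = (\<Union>i\<in>{1..k}. {gen i, inv (gen i)})"
    and "generate G G1 = carrier G"
    and "Metric_space X d"
    and "compact_space (Metric_space.mtopology X d)"
    and "continuous_group_action G X d T"
    and "action_specification G G1 X d T"
    and "g \<in> G1"
    and "\<And>n::nat. n \<ge> 1 \<Longrightarrow> g [^] n \<noteq> \<one>"
  shows "map_specification X d (T g)"
proof -
  interpret group G by fact
  interpret group_action G X T
    using assms(7) by (simp add: continuous_group_action_def)
  have "finite G1"
    using assms(3) by simp
  have g: "g \<in> carrier G"
    using assms(2,3,9) by auto
  show ?thesis
    unfolding map_specification_def
  proof (intro conjI allI impI)
    show "continuous_map (Metric_space.mtopology X d) (Metric_space.mtopology X d) (T g)"
      using assms(7) g by (rule continuous_group_action_apply)
  next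
    fix \<delta> :: real
    assume "\<delta> > 0"
    then obtain q :: real where q: "\<forall>(I::nat set) \<Lambda> z.
        finite I \<and> (\<forall>i\<in>I. \<Lambda> i \<subseteq> carrier G) \<and> (\<forall>i\<in>I. z i \<in> X) \<and>
        (\<forall>i\<in>I. \<forall>j\<in>I. i \<noteq> j \<longrightarrow>
          ereal q < ereal_of_enat (word_setdist G G1 (\<Lambda> i) (\<Lambda> j))) \<longrightarrow>
        (\<exists>y\<in>X. \<forall>i\<in>I. \<forall>h\<in>\<Lambda> i. d (T h y) (T h (z i)) < \<delta>)"
      using assms(8)[unfolded action_specification_def, THEN spec[of _ \<delta>], THEN mp]
      by (elim meta_impE exE conjE) assumption+
    \<comment> \<open>A distance of at least \<open>N + 1\<close> exceeds \<open>q\<close>, so it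
      suffices to leave all balls of radius at most \<open>N\<close>.\<close>
    define N where "N = nat \<lceil>q\<rceil>"
    have "finite (\<Union>n\<le>N. word_ball G G1 n)"
      using \<open>finite G1\<close> by (simp add: finite_word_ball)
    from eventually_nat_pow_notin_finite[OF g assms(10) this] obtain M
      where "\<forall>m\<ge>M. g [^] (m::nat) \<notin> (\<Union>n\<le>N. word_ball G G1 n)
        \<and> inv (g [^] m) \<notin> (\<Union>n\<le>N. word_ball G G1 n)"
      by blast
    then have M: "g [^] m \<notin> word_ball G G1 n" "inv (g [^] m) \<notin> word_ball G G1 n"
      if "M \<le> m" "n \<le> N" for m n :: nat
      using that by auto
    show "\<exists>p\<^sub>0::nat. p\<^sub>0 \<ge> 1 \<and>
      (\<forall>(k::nat) (x::nat \<Rightarrow> 'x) (n::nat \<Rightarrow> nat) (p::nat \<Rightarrow> nat).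
        k \<ge> 1 \<and> (\<forall>i\<in>{1..k}. x i \<in> X \<and> n i \<ge> 1 \<and> p i \<ge> 1 \<and> p i \<ge> p\<^sub>0) \<longrightarrow>
        (\<exists>y\<in>X.
          (\<forall>j\<le>n 1. d ((T g ^^ j) y) ((T g ^^ j) (x 1)) \<le> \<delta>) \<and>
          (\<forall>i\<in>{2..k}. \<forall>j\<le>n i.
            d ((T g ^^ (j + (\<Sum>l=1..<i. n l + p l))) y) ((T g ^^ j) (x i)) \<le> \<delta>)))"
    \<comment> \<open>\<open>M\<close> depends only on \<open>g\<close>, \<open>G1\<close> and
      \<open>q\<close>, hence not on the orbit segments. Gaps of length \<open>M\<close> would
      already separate them; the successor ensures a value of at least 1.\<close>
    proof (intro exI[of _ "Suc M"] conjI allI impI)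
      show "1 \<le> Suc M" by simp
    next
      fix k :: nat and x :: "nat \<Rightarrow> 'x" and n p :: "nat \<Rightarrow> nat"
      assume "k \<ge> 1 \<and> (\<forall>i\<in>{1..k}. x i \<in> X \<and> n i \<ge> 1 \<and> p i \<ge> 1 \<and> p i \<ge> Suc M)"
      then have "k \<ge> 1" and x: "\<And>i. i \<in> {1..k} \<Longrightarrow> x i \<in> X"
        and p: "\<And>i. i \<in> {1..k} \<Longrightarrow> M < p i"
        by (auto simp: Suc_le_eq)
      \<comment> \<open>\<open>a i\<close> is the time at which segment \<open>i\<close> starts, and
        \<open>z i\<close> is chosen so that it reaches \<open>x i\<close> at that time.\<close>
      define a where "a i = (\<Sum>l=1..<i. n l + p l)" for i
      define \<Lambda> where "\<Lambda> i = (\<lambda>j. g [^] (j + a i)) ` {..n i}" for i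
      define z where "z i = T (inv (g [^] a i)) (x i)" for i
      \<comment> \<open>\<open>a (Suc i)\<close> is \<open>a i + n i + p i\<close> with
        \<open>p i > M\<close>, and \<open>a\<close> is monotone.\<close>
      have gap: "a i + n i + M < a j" if "i \<in> {1..k}" "i < j" for i j
      proof -
        have "a i + n i + M < a (Suc i)"
          using that p[of i] by (simp add: a_def)
        also have "\<dots> \<le> a j"
          unfolding a_def using that by (intro sum_mono2) auto
        finally show ?thesis .
      qed
      have "ereal q < ereal_of_enat (word_setdist G G1 (\<Lambda> i) (\<Lambda> j))"
        if ij: "i \<in> {1..k}" "j \<in> {1..k}" "i \<noteq> j" for i j
      proof -
        have "enat (Suc N) \<le> word_setdist G G1 (\<Lambda> i) (\<Lambda> j)"
        proof (rule Suc_le_word_setdist)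
          fix b c r
          assume "b \<in> \<Lambda> i" "c \<in> \<Lambda> j" "r \<le> N"
          then obtain s t where st: "s \<le> n i" "b = g [^] (s + a i)" "t \<le> n j" "c = g [^] (t + a j)"
            by (auto simp: \<Lambda>_def)
          \<comment> \<open>Each time in the later window exceeds each time in the earlier one by
            more than \<open>M\<close>; the case depends on which of \<open>i\<close> and
            \<open>j\<close> is smaller.\<close>
          consider "s + a i + M < t + a j" | "t + a j + M < s + a i"
            using gap[of i j] gap[of j i] ij st(1,3) by (cases i j rule: linorder_cases) auto
          then show "inv b \<otimes> c \<notin> word_ball G G1 r"
          proof cases
            case 1
            then show ?thesis
              using M[of "t + a j - (s + a i)" r] \<open>r \<le> N\<close> g
              by (simp add: st inv_nat_pow_mult_nat_pow)
          next
            case 2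
            then show ?thesis
              using M[of "s + a i - (t + a j)" r] \<open>r \<le> N\<close> g
              by (simp add: st inv_nat_pow_mult_nat_pow)
          qed
        qed
        then have "ereal_of_enat (enat (Suc N)) \<le> ereal_of_enat (word_setdist G G1 (\<Lambda> i) (\<Lambda> j))"
          by (simp only: ereal_of_enat_le_iff)
        moreover have "q < real (Suc N)"
          unfolding N_def by linarith
        ultimately show ?thesis
          by (metis ereal_of_enat_simps(1) ereal_less(3) less_le_trans less_ereal.simps(1))
      qed
      moreover have "\<Lambda> i \<subseteq> carrier G" for i
        using g by (auto simp: \<Lambda>_def)
      moreover have "z i \<in> X" if "i \<in> {1..k}" for i
        unfolding z_def using that x g by (intro element_image[OF _ _ refl]) auto
      ultimately obtain y where "y \<in> X"
        and y: "\<And>i h. i \<in> {1..k} \<Longrightarrow> h \<in> \<Lambda> i \<Longrightarrow> d (T h y) (T h (z i)) < \<delta>"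
        using q[THEN spec[of _ "{1..k}"], THEN spec[of _ \<Lambda>], THEN spec[of _ z]] by auto
      \<comment> \<open>The element \<open>g [^] (j + a i)\<close> of \<open>\<Lambda> i\<close>
        takes \<open>z i\<close> to the \<open>j\<close>-th iterate of \<open>x i\<close>, and
        \<open>y\<close> to its own iterate at time \<open>j + a i\<close>.\<close>
      have shadow: "d ((T g ^^ (j + a i)) y) ((T g ^^ j) (x i)) \<le> \<delta>"
        if "i \<in> {1..k}" "j \<le> n i" for i j
      proof -
        have "T (g [^] (j + a i)) (z i) = T (g [^] (j + a i) \<otimes> inv (g [^] a i)) (x i)"
          unfolding z_def using composition_rule x g that by simp
        also have "g [^] (j + a i) \<otimes> inv (g [^] a i) = g [^] j"
          using g by (simp add: nat_pow_mult[symmetric] m_assoc)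
        finally have "T (g [^] (j + a i)) (z i) = (T g ^^ j) (x i)"
          using funpow_eq_nat_pow g x that by simp
        moreover have "T (g [^] (j + a i)) y = (T g ^^ (j + a i)) y"
          using funpow_eq_nat_pow g \<open>y \<in> X\<close> by simp
        moreover have "g [^] (j + a i) \<in> \<Lambda> i"
          using that by (auto simp: \<Lambda>_def)
        ultimately show ?thesis
          using y that by (metis less_imp_le)
      qed
      \<comment> \<open>The empty sum makes the unshifted clause for the first segment the case
        \<open>i = 1\<close> of \<open>shadow\<close>.\<close>
      have "a 1 = 0"
        by (simp add: a_def)
      then have "\<forall>j\<le>n 1. d ((T g ^^ j) y) ((T g ^^ j) (x 1)) \<le> \<delta>"
        using shadow[of 1] \<open>k \<ge> 1\<close> by simp
      with \<open>y \<in> X\<close> shadow show "\<exists>y\<in>X.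
          (\<forall>j\<le>n 1. d ((T g ^^ j) y) ((T g ^^ j) (x 1)) \<le> \<delta>) \<and>
          (\<forall>i\<in>{2..k}. \<forall>j\<le>n i.
            d ((T g ^^ (j + (\<Sum>l=1..<i. n l + p l))) y) ((T g ^^ j) (x i)) \<le> \<delta>)"
        unfolding a_def by (intro bexI[of _ y]) auto
    qed
  qed
qed

end
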